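(* Let $\alpha>0$, $k>0$, and let $\bm m_h^n\in V_N^3$ satisfy $|\bm m_h^n(\bm x_j)|=1$ at every grid node. Suppose $(\bm v_h^{n+1/2},r_h)\in V_N^3\times V_N$ solves exactly the midpoint equations given in the context, with $\bm m_h^{n+1/2}=\bm m_h^n+\frac k2\bm v_h^{n+1/2}$ and $\bm m_h^{n+1}=\bm m_h^n+k\bm v_h^{n+1/2}$. Then $$|\bm m_h^{n+1}(\bm x_j)|=1\qquad\text{for every grid node }\bm x_j .$$ Suppose additionally that the applied field is time independent and that the discrete effective field is generated by a quadratic-affine energy $g_N:V_N^3\to\mathbb R$, i.e. $g_N$ is a polynomial functional of degree at most two with $$Dg_N(\bm m)[\bm\phi]=-(\bm h_{\rm eff,N}(\bm m),\bm\phi)_N\qquad\text{for all }\bm m,\bm\phi\in V_N^3 .$$ (This class includes the discrete exchange, periodic demagnetization, uniaxial anisotropy and Zeeman terms described in the context.) Then $$g_N(\bm m_h^{n+1})-g_N(\bm m_h^n)=-\frac{\alpha k}{1+\alpha^2}\|\bm v_h^{n+1/2}\|_N^2\le0 .$$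
   Context: Grid: a uniform periodic Cartesian grid $\mathcal G_N$ with $N_g$ nodes on $\Omega=\prod_{\ell=1}^d(0,L_\ell)$, $d\in\{2,3\}$. $V_N$ is the corresponding space of real trigonometric polynomials, identified with real grid functions; $(u,v)_N=\frac{|\Omega|}{N_g}\sum_j u(\bm x_j)\cdot v(\bm x_j)$ and $\|\cdot\|_N$ is the induced norm. Products such as $\bm m\times\bm v$, $\bm m\cdot\bm v$ are taken nodewise. $-\Delta_N$ multiplies the discrete Fourier coefficient at wave vector $\bm\xi$ by $|\bm\xi|^2$ (componentwise); it is self-adjoint and positive semidefinite for $(\cdot,\cdot)_N$. Let $C_{\rm ex}>0$ be the exchange coefficient, $\widehat C_{\rm exc}=(1+\alpha^2)C_{\rm ex}$, and let $\bm h_{\rm low}(\bm m,t)\in V_N^3$ be the lower-order field. The midpoint equations are: for all $(\bm\phi_h,q_h)\in V_N^3\times V_N$, $$\alpha(\bm v_h^{n+1/2},\bm\phi_h)_N+(\bm m_h^{n+1/2}\times\bm v_h^{n+1/2},\bm\phi_h)_N+\widehat C_{\rm exc}(-\Delta_N\bm m_h^{n+1/2},\bm\phi_h)_N+(\bm m_h^{n+1/2}\cdot\bm\phi_h,r_h)_N=(1+\alpha^2)(\bm h_{\rm low}(\bm m_h^{n+1/2},t_{n+1/2}),\bm\phi_h)_N,$$ $$(\bm v_h^{n+1/2}\cdot\bm m_h^{n+1/2},q_h)_N=0 .$$ The discrete effective field is $\bm h_{\rm eff,N}(\bm m)=C_{\rm ex}\Delta_N\bm m+\bm h_{\rm low}(\bm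 m)$ (for time-independent $\bm h_{\rm low}$). The terms mentioned as included: $\bm h_{\rm low}(\bm m)=\mathcal D_N\bm m+K\,\bm e(\bm m\cdot\bm e)+\bm h_{\rm ext}$, where $K\in\mathbb R$, $\bm e$ is a fixed unit vector, $\bm h_{\rm ext}$ is a fixed field, and $\mathcal D_N$ is the discrete periodic demagnetization operator, i.e. the Fourier discretization of $\bm m\mapsto-\nabla\phi$ with $\Delta\phi=\operatorname{div}\bm m$ and $\phi$ periodic with zero mean (symbol $-\bm\xi\bm\xi^T/|\bm\xi|^2$ for $\bm\xi\ne0$ and $0$ for $\bm\xi=0$), a real linear operator self-adjoint for $(\cdot,\cdot)_N$. The corresponding energy is $$g_N(\bm m)=\tfrac{C_{\rm ex}}2(-\Delta_N\bm m,\bm m)_N-\tfrac12(\mathcal D_N\bm m,\bm m)_N+\tfrac K2\bigl(1-(\bm e\cdot\bm m)^2,1\bigr)_N-(\bm h_{\rm ext},\bm m)_N .$$ *)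

theory Defs
  imports "HOL-Analysis.Analysis"
begin

text \<open>
  The \<open>d\<close> periodic directions are the first \<open>d\<close> coordinate directions of \<open>\<real>\<^sup>3\<close>. Nodes and wave
  vectors are embedded in \<open>\<real>\<^sup>3\<close> (their last component is \<open>0\<close> if \<open>d = 2\<close>), because for \<open>d = 2\<close>
  the demagnetization symbol has to act on \<open>\<real>\<^sup>3\<close>-valued fields. Only \<open>L i\<close> and \<open>N i\<close> with
  \<open>i \<in> directions d\<close> matter.
\<close>

definition directions :: "nat \<Rightarrow> 3 set" where
  "directions d = of_nat ` {1..d}"

definition grid_nodes :: "nat \<Rightarrow> (3 \<Rightarrow> real) \<Rightarrow> (3 \<Rightarrow> nat) \<Rightarrow> (real^3) set" where
  "grid_nodes d L N =
     {\<chi> i. if i \<in> directions d then real (j i) * L i / real (N i) else 0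
      | j :: 3 \<Rightarrow> nat. \<forall>i\<in>directions d. j i < N i}"

definition domain_volume :: "nat \<Rightarrow> (3 \<Rightarrow> real) \<Rightarrow> real" where
  "domain_volume d L = (\<Prod>i\<in>directions d. L i)"

text \<open>
  \<open>x :: 'p \<Rightarrow> real^3\<close> enumerates the nodes, so \<open>CARD('p)\<close> is the number of nodes. Real
  trigonometric polynomials are identified with their nodal values: \<open>V\<^sub>N\<close> is \<open>real^'p\<close> and
  \<open>V\<^sub>N\<^sup>3\<close> is \<open>real^3^'p\<close>.
\<close>

definition periodic_grid ::
  "nat \<Rightarrow> (3 \<Rightarrow> real) \<Rightarrow> (3 \<Rightarrow> nat) \<Rightarrow> ('p::finite \<Rightarrow> real^3) \<Rightarrow> bool" where
  "periodic_grid d L N x \<longleftrightarrow>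
     d \<in> {2, 3} \<and> (\<forall>i\<in>directions d. 0 < L i \<and> 0 < N i) \<and>
     bij_betw x UNIV (grid_nodes d L N)"

definition ip_N :: "nat \<Rightarrow> (3 \<Rightarrow> real) \<Rightarrow> 'a::real_inner^'p \<Rightarrow> 'a^'p \<Rightarrow> real" where
  "ip_N d L u v = domain_volume d L / real CARD('p) * (\<Sum>j\<in>UNIV. u $ j \<bullet> v $ j)"

definition norm_N :: "nat \<Rightarrow> (3 \<Rightarrow> real) \<Rightarrow> 'a::real_inner^'p \<Rightarrow> real" where
  "norm_N d L u = sqrt (ip_N d L u u)"

definition node_cross :: "real^3^'p \<Rightarrow> real^3^'p \<Rightarrow> real^3^'p" where
  "node_cross u v = (\<chi> j. cross3 (u $ j) (v $ j))"

definition node_dot :: "real^3^'p \<Rightarrow> real^3^'p \<Rightarrow> real^'p" where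
  "node_dot u v = (\<chi> j. u $ j \<bullet> v $ j)"


definition wave_vector :: "nat \<Rightarrow> (3 \<Rightarrow> real) \<Rightarrow> (3 \<Rightarrow> int) \<Rightarrow> real^3" where
  "wave_vector d L \<kappa> = (\<chi> i. if i \<in> directions d then 2 * pi * real_of_int (\<kappa> i) / L i else 0)"

definition fourier_coeff :: "('p::finite \<Rightarrow> real^3) \<Rightarrow> real^'p \<Rightarrow> real^3 \<Rightarrow> complex" where
  "fourier_coeff x w \<xi> =
     (\<Sum>j\<in>UNIV. complex_of_real (w $ j) * cis (- (\<xi> \<bullet> x j))) / of_nat CARD('p)"

text \<open>
  For even \<open>N i\<close> the frequencies \<open>\<plusminus> N i / 2\<close> coincide on the grid. As usual for real
  trigonometric interpolation, the coefficient is divided equally among them; thus a real grid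
  function \<open>w\<close> is represented by the real trigonometric polynomial
  \<open>\<Sum>\<kappa>. mode_weight d N \<kappa> * fourier_coeff x w \<xi>\<^sub>\<kappa> * cis (\<xi>\<^sub>\<kappa> \<bullet> y)\<close>.
\<close>

definition modes :: "nat \<Rightarrow> (3 \<Rightarrow> nat) \<Rightarrow> (3 \<Rightarrow> int) set" where
  "modes d N =
     {\<kappa>. (\<forall>i\<in>directions d. 2 * \<bar>\<kappa> i\<bar> \<le> int (N i)) \<and> (\<forall>i. i \<notin> directions d \<longrightarrow> \<kappa> i = 0)}"

definition mode_weight :: "nat \<Rightarrow> (3 \<Rightarrow> nat) \<Rightarrow> (3 \<Rightarrow> int) \<Rightarrow> real" where
  "mode_weight d N \<kappa> = (\<Prod>i\<in>directions d. if 2 * \<bar>\<kappa> i\<bar> = int (N i) then 1 / 2 else 1)"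

text \<open>
  The nodal values of the Fourier multiplier with matrix symbol \<open>S\<close>. For an even real symbol, as
  below, the sum over the modes is already real, and \<open>Re\<close> is only a coercion.
\<close>

definition fourier_multiplier ::
  "nat \<Rightarrow> (3 \<Rightarrow> real) \<Rightarrow> (3 \<Rightarrow> nat) \<Rightarrow> ('p::finite \<Rightarrow> real^3) \<Rightarrow>
    (real^3 \<Rightarrow> real^3^3) \<Rightarrow> real^3^'p \<Rightarrow> real^3^'p" where
  "fourier_multiplier d L N x S u = (\<chi> j i.
     Re (\<Sum>\<kappa>\<in>modes d N. let \<xi> = wave_vector d L \<kappa> in
           complex_of_real (mode_weight d N \<kappa>) *
           (\<Sum>l\<in>UNIV. complex_of_real (S \<xi> $ i $ l) * fourier_coeff x (\<chi> j'. u $ j' $ l) \<xi>) *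
           cis (\<xi> \<bullet> x j)))"

definition neg_laplacian_N ::
  "nat \<Rightarrow> (3 \<Rightarrow> real) \<Rightarrow> (3 \<Rightarrow> nat) \<Rightarrow> ('p::finite \<Rightarrow> real^3) \<Rightarrow> real^3^'p \<Rightarrow> real^3^'p" where
  "neg_laplacian_N d L N x = fourier_multiplier d L N x (\<lambda>\<xi>. mat ((norm \<xi>)\<^sup>2))"

definition demag_N ::
  "nat \<Rightarrow> (3 \<Rightarrow> real) \<Rightarrow> (3 \<Rightarrow> nat) \<Rightarrow> ('p::finite \<Rightarrow> real^3) \<Rightarrow> real^3^'p \<Rightarrow> real^3^'p" where
  "demag_N d L N x = fourier_multiplier d L N x
     (\<lambda>\<xi>. if \<xi> = 0 then 0 else (\<chi> i l. - (\<xi> $ i * \<xi> $ l) / (norm \<xi>)\<^sup>2))"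


definition midpoint_equations ::
  "nat \<Rightarrow> (3 \<Rightarrow> real) \<Rightarrow> (3 \<Rightarrow> nat) \<Rightarrow> ('p::finite \<Rightarrow> real^3) \<Rightarrow> real \<Rightarrow> real \<Rightarrow>
    (real^3^'p \<Rightarrow> real \<Rightarrow> real^3^'p) \<Rightarrow> real \<Rightarrow> real^3^'p \<Rightarrow> real^3^'p \<Rightarrow> real^'p \<Rightarrow> bool" where
  "midpoint_equations d L N x \<alpha> C\<^sub>e\<^sub>x h_low t_half m_half v r \<longleftrightarrow>
     (\<forall>(\<phi> :: real^3^'p) (q :: real^'p).
        \<alpha> * ip_N d L v \<phi>
        + ip_N d L (node_cross m_half v) \<phi>
        + (1 + \<alpha>\<^sup>2) * C\<^sub>e\<^sub>x * ip_N d L (neg_laplacian_N d L N x m_half) \<phi>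
        + ip_N d L (node_dot m_half \<phi>) r
        = (1 + \<alpha>\<^sup>2) * ip_N d L (h_low m_half t_half) \<phi>
      \<and> ip_N d L (node_dot v m_half) q = 0)"

definition h_eff_N ::
  "nat \<Rightarrow> (3 \<Rightarrow> real) \<Rightarrow> (3 \<Rightarrow> nat) \<Rightarrow> ('p::finite \<Rightarrow> real^3) \<Rightarrow> real \<Rightarrow>
    (real^3^'p \<Rightarrow> real^3^'p) \<Rightarrow> real^3^'p \<Rightarrow> real^3^'p" where
  "h_eff_N d L N x C\<^sub>e\<^sub>x h m = C\<^sub>e\<^sub>x *\<^sub>R (- neg_laplacian_N d L N x m) + h m"

definition quadratic_affine :: "('v::real_vector \<Rightarrow> real) \<Rightarrow> bool" where
  "quadratic_affine g \<longleftrightarrow> (\<exists>B l c. bilinear B \<and> linear l \<and> (\<forall>m. g m = B m m + l m + c))"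

definition generated_by_energy ::
  "nat \<Rightarrow> (3 \<Rightarrow> real) \<Rightarrow> (3 \<Rightarrow> nat) \<Rightarrow> ('p::finite \<Rightarrow> real^3) \<Rightarrow> real \<Rightarrow>
    (real^3^'p \<Rightarrow> real^3^'p) \<Rightarrow> (real^3^'p \<Rightarrow> real) \<Rightarrow> bool" where
  "generated_by_energy d L N x C\<^sub>e\<^sub>x h g \<longleftrightarrow>
     quadratic_affine g \<and>
     (\<forall>m. (g has_derivative (\<lambda>\<phi>. - ip_N d L (h_eff_N d L N x C\<^sub>e\<^sub>x h m) \<phi>)) (at m))"

definition standard_h_low ::
  "nat \<Rightarrow> (3 \<Rightarrow> real) \<Rightarrow> (3 \<Rightarrow> nat) \<Rightarrow> ('p::finite \<Rightarrow> real^3) \<Rightarrow>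
    real \<Rightarrow> real^3 \<Rightarrow> real^3^'p \<Rightarrow> real^3^'p \<Rightarrow> real^3^'p" where
  "standard_h_low d L N x K e h_ext m =
     demag_N d L N x m + (\<chi> j. (K * (m $ j \<bullet> e)) *\<^sub>R e) + h_ext"

definition standard_energy ::
  "nat \<Rightarrow> (3 \<Rightarrow> real) \<Rightarrow> (3 \<Rightarrow> nat) \<Rightarrow> ('p::finite \<Rightarrow> real^3) \<Rightarrow> real \<Rightarrow>
    real \<Rightarrow> real^3 \<Rightarrow> real^3^'p \<Rightarrow> real^3^'p \<Rightarrow> real" where
  "standard_energy d L N x C\<^sub>e\<^sub>x K e h_ext m =
     C\<^sub>e\<^sub>x / 2 * ip_N d L (neg_laplacian_N d L N x m) m
     - 1 / 2 * ip_N d L (demag_N d L N x m) m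
     + K / 2 * ip_N d L (\<chi> j. 1 - (e \<bullet> m $ j)\<^sup>2) (\<chi> j. (1::real))
     - ip_N d L h_ext m"

end

theory Submission
  imports Defs
begin

text \<open>
  Testing the constraint with \<open>q = v \<cdot> m\<^sub>h\<^sub>a\<^sub>l\<^sub>f\<close> gives \<open>v \<cdot> m\<^sub>h\<^sub>a\<^sub>l\<^sub>f = 0\<close> at every node, which is exactly
  \<open>\<bar>m + k v\<bar>\<^sup>2 = \<bar>m\<bar>\<^sup>2\<close>. Testing the first equation with \<open>\<phi> = v\<close> then removes the precession and the
  multiplier terms and leaves \<open>(1 + \<alpha>\<^sup>2) (h\<^sub>e\<^sub>f\<^sub>f(m\<^sub>h\<^sub>a\<^sub>l\<^sub>f), v) = \<alpha> \<parallel>v\<parallel>\<^sup>2\<close>; for a polynomial of degree at most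
  two the midpoint rule \<open>g (m + k v) - g m = k Dg(m\<^sub>h\<^sub>a\<^sub>l\<^sub>f)[v]\<close> is exact. The standard effective field
  is the gradient of a quadratic energy because a Fourier multiplier with a real symmetric symbol is
  self-adjoint.
\<close>

section \<open>The discrete inner product and nodewise vector identities\<close>

lemma ip_N_eq_inner: "ip_N d L u v = domain_volume d L / real CARD('p) * (u \<bullet> v)"
  for u v :: "'a::real_inner^'p"
  by (simp add: ip_N_def inner_vec_def)

lemma domain_volume_pos: "periodic_grid d L N x \<Longrightarrow> domain_volume d L > 0"
  by (auto simp: periodic_grid_def domain_volume_def intro!: prod_pos)

lemma ip_N_self_eq_0_iff:
  fixes u :: "'a::real_inner^'p"
  assumes "periodic_grid d L N x"
  shows "ip_N d L u u = 0 \<longleftrightarrow> u = 0"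
  using domain_volume_pos[OF assms] by (simp add: ip_N_eq_inner)

lemma norm_N_power2:
  fixes u :: "'a::real_inner^'p"
  assumes "periodic_grid d L N x"
  shows "(norm_N d L u)\<^sup>2 = ip_N d L u u"
  using domain_volume_pos[OF assms] by (simp add: ip_N_eq_inner norm_N_def)

lemma node_cross_orthogonal: "ip_N d L (node_cross u v) v = 0"
  by (simp add: ip_N_def node_cross_def dot_cross_self)

text \<open>The squared norm changes by \<open>2 * k\<close> times the inner product of
  \<open>v\<close> with the midpoint of the segment from \<open>a\<close> to
  \<open>a + k *\<^sub>R v\<close>.\<close>

lemma norm_add_scaleR_eq:
  fixes a v :: "'a::real_inner"
  assumes "v \<bullet> (a + (k / 2) *\<^sub>R v) = 0"
  shows "norm (a + k *\<^sub>R v) = norm a"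
proof -
  have "(norm (a + k *\<^sub>R v))\<^sup>2 = (norm a)\<^sup>2 + 2 * k * (v \<bullet> (a + (k / 2) *\<^sub>R v))"
    unfolding power2_norm_eq_inner
    by (simp add: inner_add_left inner_add_right inner_commute algebra_simps)
  then show ?thesis
    using assms by simp
qed

section \<open>Exactness of the midpoint rule for polynomials of degree at most two\<close>

lemma has_derivative_quadratic_affine:
  fixes B :: "'v::euclidean_space \<Rightarrow> 'v \<Rightarrow> real"
  assumes "bilinear B" and "linear l"
  shows "((\<lambda>m. B m m + l m + c) has_derivative (\<lambda>\<phi>. B m \<phi> + B \<phi> m + l \<phi>)) (at m)"
proof -
  have "bounded_bilinear B"
    using assms(1) by (simp add: bilinear_conv_bounded_bilinear)
  then have B: "((\<lambda>m. B m m) has_derivative (\<lambda>\<phi>. B m \<phi> + B \<phi> m)) (at m)"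
    by (rule bounded_bilinear.FDERIV) (rule has_derivative_ident)+
  have l: "(l has_derivative l) (at m)"
    using assms(2) by (simp add: linear_linear bounded_linear_imp_has_derivative)
  show ?thesis
    using has_derivative_add[OF has_derivative_add[OF B l] has_derivative_const[of c]] by simp
qed

text \<open>Expand both values about the midpoint \<open>h\<close>: the end points are
  \<open>h\<close> plus and minus \<open>(k / 2) *\<^sub>R v\<close>, so the second-order terms in
  \<open>v\<close> cancel in the difference and only the first-order part survives.\<close>

lemma quadratic_affine_midpoint_rule:
  fixes g :: "'v::euclidean_space \<Rightarrow> real"
  assumes "quadratic_affine g" and "(g has_derivative g') (at (m + (k / 2) *\<^sub>R v))"
  shows "g (m + k *\<^sub>R v) - g m = k * g' v"
proof -
  obtain B l c where B: "bilinear B" and l: "linear l" and g: "\<And>m. g m = B m m + l m + c"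
    using assms(1) by (auto simp: quadratic_affine_def)
  define h where "h = m + (k / 2) *\<^sub>R v"
  have "(g has_derivative (\<lambda>\<phi>. B h \<phi> + B \<phi> h + l \<phi>)) (at h)"
    using has_derivative_quadratic_affine[OF B l, of c h] by (simp add: g[abs_def])
  \<comment> \<open>Uniqueness of the derivative identifies the given \<open>g'\<close> with the one
    computed from the representation by \<open>B\<close>, \<open>l\<close> and
    \<open>c\<close>.\<close>
  with assms(2) have "g' = (\<lambda>\<phi>. B h \<phi> + B \<phi> h + l \<phi>)"
    unfolding h_def by (rule has_derivative_unique)
  then show ?thesis
    by (simp add: g h_def bilinear_ladd[OF B] bilinear_radd[OF B] bilinear_lmul[OF B]
        bilinear_rmul[OF B] linear_add[OF l] linear_scale[OF l] algebra_simps)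
qed

section \<open>Linearity and self-adjointness of Fourier multipliers\<close>

lemma fourier_coeff_add:
  "fourier_coeff x (\<chi> j. u $ j $ l + v $ j $ l) \<xi> =
     fourier_coeff x (\<chi> j. u $ j $ l) \<xi> + fourier_coeff x (\<chi> j. v $ j $ l) \<xi>"
  by (simp add: fourier_coeff_def sum.distrib algebra_simps add_divide_distrib)

lemma fourier_coeff_scaleR:
  "fourier_coeff x (\<chi> j. c * u $ j $ l) \<xi> = complex_of_real c * fourier_coeff x (\<chi> j. u $ j $ l) \<xi>"
  by (simp add: fourier_coeff_def sum_distrib_left algebra_simps)

lemma linear_fourier_multiplier: "linear (fourier_multiplier d L N x S)"
proof (rule linearI)
  show "fourier_multiplier d L N x S (u + v) =
      fourier_multiplier d L N x S u + fourier_multiplier d L N x S v" for u v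
    by (simp add: fourier_multiplier_def vec_eq_iff Let_def fourier_coeff_add sum.distrib
        algebra_simps)
  show "fourier_multiplier d L N x S (c *\<^sub>R u) = c *\<^sub>R fourier_multiplier d L N x S u" for c u
  proof -
    \<comment> \<open>The scalar passes through both sums whatever the weights, symbol entries and
      exponentials are, so these are kept abstract.\<close>
    have "(\<Sum>\<kappa>\<in>modes d N. complex_of_real (w \<kappa>) * (\<Sum>l\<in>UNIV. complex_of_real (s \<kappa> l) * (complex_of_real c * f l \<kappa>)) * e \<kappa>)
      = complex_of_real c * (\<Sum>\<kappa>\<in>modes d N. complex_of_real (w \<kappa>) * (\<Sum>l\<in>UNIV. complex_of_real (s \<kappa> l) * f l \<kappa>) * e \<kappa>)"
      for w s and f :: "3 \<Rightarrow> (3 \<Rightarrow> int) \<Rightarrow> complex" and e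
      by (simp add: sum_distrib_left sum_distrib_right mult_ac)
    then show ?thesis
      by (simp add: fourier_multiplier_def vec_eq_iff Let_def fourier_coeff_scaleR)
  qed
qed

text \<open>Since \<open>w\<close> is real, conjugating its Fourier coefficient only flips the sign
  of the exponent.\<close>

lemma sum_cis_eq_cnj_fourier_coeff:
  "(\<Sum>j\<in>UNIV. complex_of_real (w $ j) * cis (\<xi> \<bullet> x j)) =
     of_nat CARD('p) * cnj (fourier_coeff x w \<xi>)" for w :: "real^'p::finite"
  by (simp add: fourier_coeff_def cis_cnj)

text \<open>A Parseval-type formula: summing over the nodes first turns the exponentials into
  conjugate coefficients of \<open>w\<close>. Both arguments then enter only through their Fourier
  coefficients, and the symmetry of the form can be read off from the symbol.\<close>

lemma inner_fourier_multiplier: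
  fixes x :: "'p::finite \<Rightarrow> real^3" and d :: nat and L :: "3 \<Rightarrow> real"
  defines "F \<equiv> \<lambda>u l \<kappa>. fourier_coeff x (\<chi> j. u $ j $ l) (wave_vector d L \<kappa>)"
  shows "fourier_multiplier d L N x S u \<bullet> w = real CARD('p) *
    (\<Sum>\<kappa>\<in>modes d N. mode_weight d N \<kappa> *
      (\<Sum>i\<in>UNIV. \<Sum>l\<in>UNIV. S (wave_vector d L \<kappa>) $ i $ l * Re (F u l \<kappa> * cnj (F w i \<kappa>))))"
proof -
  define a where "a i \<kappa> = complex_of_real (mode_weight d N \<kappa>) *
    (\<Sum>l\<in>UNIV. complex_of_real (S (wave_vector d L \<kappa>) $ i $ l) * F u l \<kappa>)" for i \<kappa>
  define E where "E \<kappa> j = cis (wave_vector d L \<kappa> \<bullet> x j)" for \<kappa> j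
  have Re_mult: "Re (z * complex_of_real c) = Re z * c" "Re (complex_of_real c * z) = c * Re z"
    for z c
    by simp_all
  have "fourier_multiplier d L N x S u \<bullet> w =
      (\<Sum>j\<in>UNIV. \<Sum>i\<in>UNIV. Re (\<Sum>\<kappa>\<in>modes d N. a i \<kappa> * E \<kappa> j) * w $ j $ i)"
    by (simp add: inner_vec_def fourier_multiplier_def Let_def a_def E_def F_def)
  \<comment> \<open>The nodal values of \<open>w\<close> are real and may be moved inside
    \<open>Re\<close>.\<close>
  also have "\<dots> = Re (\<Sum>j\<in>UNIV. \<Sum>i\<in>UNIV. \<Sum>\<kappa>\<in>modes d N. a i \<kappa> * E \<kappa> j * complex_of_real (w $ j $ i))"
    by (simp only: Re_sum sum_distrib_right Re_mult)
  also have "(\<Sum>j\<in>UNIV. \<Sum>i\<in>UNIV. \<Sum>\<kappa>\<in>modes d N. a i \<kappa> * E \<kappa> j * complex_of_real (w $ j $ i)) =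
      (\<Sum>j\<in>UNIV. \<Sum>\<kappa>\<in>modes d N. \<Sum>i\<in>UNIV. a i \<kappa> * E \<kappa> j * complex_of_real (w $ j $ i))"
    by (rule sum.cong[OF refl sum.swap])
  also have "\<dots> = (\<Sum>\<kappa>\<in>modes d N. \<Sum>j\<in>UNIV. \<Sum>i\<in>UNIV. a i \<kappa> * E \<kappa> j * complex_of_real (w $ j $ i))"
    by (rule sum.swap)
  also have "\<dots> = (\<Sum>\<kappa>\<in>modes d N. \<Sum>i\<in>UNIV. \<Sum>j\<in>UNIV. a i \<kappa> * E \<kappa> j * complex_of_real (w $ j $ i))"
    by (rule sum.cong[OF refl sum.swap])
  also have "\<dots> = (\<Sum>\<kappa>\<in>modes d N. \<Sum>i\<in>UNIV. a i \<kappa> * (of_nat CARD('p) * cnj (F w i \<kappa>)))"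
    unfolding F_def sum_cis_eq_cnj_fourier_coeff[symmetric]
    by (simp add: E_def sum_distrib_left mult_ac)
  \<comment> \<open>The symbol is real, so all scalar factors are gathered into one real number and
    \<open>Re\<close> falls on the product of coefficients alone.\<close>
  also have "\<dots> = (\<Sum>\<kappa>\<in>modes d N. \<Sum>i\<in>UNIV. \<Sum>l\<in>UNIV. complex_of_real
        (real CARD('p) * mode_weight d N \<kappa> * S (wave_vector d L \<kappa>) $ i $ l) *
        (F u l \<kappa> * cnj (F w i \<kappa>)))"
    by (simp add: a_def sum_distrib_left sum_distrib_right mult_ac)
  finally show ?thesis
    by (simp only: Re_sum Re_mult sum_distrib_left mult.assoc)
qed

lemma fourier_multiplier_self_adjoint:
  fixes x :: "'p::finite \<Rightarrow> real^3"
  assumes "\<And>\<xi>. transpose (S \<xi>) = S \<xi>"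
  shows "fourier_multiplier d L N x S u \<bullet> w = u \<bullet> fourier_multiplier d L N x S w"
proof -
  have S: "S \<xi> $ i $ l = S \<xi> $ l $ i" for \<xi> i l
    using arg_cong[OF assms[of \<xi>], of "\<lambda>M. M $ i $ l"] by (simp add: transpose_def)
  \<comment> \<open>Exchanging \<open>i\<close> and \<open>l\<close> leaves the symmetric symbol
    fixed; what remains is a conjugation of the product, which \<open>Re\<close> does not
    see.\<close>
  have swap: "(\<Sum>i\<in>UNIV. \<Sum>l\<in>UNIV. S \<xi> $ i $ l * Re (a l * cnj (b i))) =
        (\<Sum>i\<in>UNIV. \<Sum>l\<in>UNIV. S \<xi> $ i $ l * Re (b l * cnj (a i)))" for \<xi> a b
    by (subst sum.swap, intro sum.cong refl, subst S) (simp add: mult.commute)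
  show ?thesis
    unfolding inner_commute[of u] inner_fourier_multiplier
    by (intro arg_cong[where f = "(*) _"] sum.cong[OF refl, where A = "modes d N"] swap)
qed

lemma linear_neg_laplacian_N: "linear (neg_laplacian_N d L N x)"
  unfolding neg_laplacian_N_def by (rule linear_fourier_multiplier)

lemma linear_demag_N: "linear (demag_N d L N x)"
  unfolding demag_N_def by (rule linear_fourier_multiplier)

lemma neg_laplacian_N_self_adjoint:
  "neg_laplacian_N d L N x u \<bullet> w = u \<bullet> neg_laplacian_N d L N x w"
  unfolding neg_laplacian_N_def by (rule fourier_multiplier_self_adjoint) (rule transpose_mat)

lemma demag_N_self_adjoint: "demag_N d L N x u \<bullet> w = u \<bullet> demag_N d L N x w"
  unfolding demag_N_def
  by (rule fourier_multiplier_self_adjoint) (simp add: transpose_def vec_eq_iff mult.commute)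

section \<open>The standard energy generates the standard effective field\<close>

text \<open>Self-adjointness merges the two terms \<open>T m \<bullet> \<phi>\<close> and
  \<open>T \<phi> \<bullet> m\<close> of the derivative, which absorbs the factor 1/2. The factor
  \<mu> leaves room for the quadrature weight of \<open>ip_N\<close>.\<close>

lemma quadratic_energy_gradient:
  fixes T :: "'v::euclidean_space \<Rightarrow> 'v" and b :: 'v and \<mu> c :: real
  assumes "linear T" and "\<And>u w. T u \<bullet> w = u \<bullet> T w"
  defines "g \<equiv> \<lambda>m. \<mu> * (T m \<bullet> m / 2 - b \<bullet> m) + c"
  shows "quadratic_affine g" and "(g has_derivative (\<lambda>\<phi>. \<mu> * ((T m - b) \<bullet> \<phi>))) (at m)"
proof -
  define B where "B u w = \<mu> * (T u \<bullet> w) / 2" for u w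
  define l where "l m = - (\<mu> * (b \<bullet> m))" for m
  have B: "bilinear B"
    unfolding bilinear_def B_def
    by (auto intro!: linearI simp: linear_add[OF assms(1)] linear_scale[OF assms(1)]
        inner_add_left inner_add_right algebra_simps add_divide_distrib)
  have l: "linear l"
    unfolding l_def by (auto intro!: linearI simp: inner_add_right algebra_simps)
  have g: "g = (\<lambda>m. B m m + l m + c)"
    by (simp add: g_def B_def l_def fun_eq_iff algebra_simps)
  show "quadratic_affine g"
    unfolding quadratic_affine_def using B l g by blast
  have "B m \<phi> + B \<phi> m + l \<phi> = \<mu> * ((T m - b) \<bullet> \<phi>)" for \<phi>
    using assms(2)[of \<phi> m] by (simp add: B_def l_def inner_diff_left inner_commute algebra_simps)
  then show "(g has_derivative (\<lambda>\<phi>. \<mu> * ((T m - b) \<bullet> \<phi>))) (at m)"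
    using has_derivative_quadratic_affine[OF B l, of c m] by (simp add: g)
qed

lemma generated_by_standard_energy:
  fixes x :: "'p::finite \<Rightarrow> real^3"
  shows "generated_by_energy d L N x C (standard_h_low d L N x K e h_ext)
    (standard_energy d L N x C K e h_ext)"
proof -
  define A :: "real^3^'p \<Rightarrow> real^3^'p" where "A m = (\<chi> j. (m $ j \<bullet> e) *\<^sub>R e)" for m
  \<comment> \<open>Exchange, demagnetization and anisotropy are combined into one self-adjoint
    operator; the Zeeman term is the linear part, with \<open>b = h_ext\<close>.\<close>
  define T where "T m = C *\<^sub>R neg_laplacian_N d L N x m - demag_N d L N x m - K *\<^sub>R A m" for m
  define \<mu> where "\<mu> = domain_volume d L / real CARD('p)"
  have "linear A"
    unfolding A_def by (auto intro!: linearI simp: vec_eq_iff inner_add_left algebra_simps)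
  then have lin: "linear T"
    unfolding T_def
    by (intro linear_compose_sub linear_compose_scale_right linear_neg_laplacian_N linear_demag_N)
  have "A u \<bullet> w = u \<bullet> A w" for u w
    by (simp add: A_def inner_vec_def[where 'b='p] inner_commute mult.commute)
  then have sym: "T u \<bullet> w = u \<bullet> T w" for u w
    by (simp add: T_def inner_diff_left inner_diff_right neg_laplacian_N_self_adjoint
        demag_N_self_adjoint)
  \<comment> \<open>The constant 1 sums to the number of nodes, which cancels against the quadrature
    weight and leaves the volume, a constant without effect on the gradient.\<close>
  have aniso: "ip_N d L (\<chi> j. 1 - (e \<bullet> m $ j)\<^sup>2) (\<chi> j. (1::real)) =
      domain_volume d L - \<mu> * (A m \<bullet> m)" for m :: "real^3^'p"
    by (simp add: ip_N_def \<mu>_def A_def inner_vec_def[where 'b='p] sum_subtractf inner_commute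
        power2_eq_square right_diff_distrib)
  have energy: "standard_energy d L N x C K e h_ext =
      (\<lambda>m. \<mu> * (T m \<bullet> m / 2 - h_ext \<bullet> m) + K / 2 * domain_volume d L)"
    by (simp add: fun_eq_iff standard_energy_def aniso)
      (simp add: ip_N_eq_inner \<mu>_def[symmetric] T_def inner_diff_left algebra_simps
        diff_divide_distrib)
  have "h_eff_N d L N x C (standard_h_low d L N x K e h_ext) m = - (T m - h_ext)" for m
    by (simp add: h_eff_N_def standard_h_low_def T_def A_def vec_eq_iff)
  then have field: "- ip_N d L (h_eff_N d L N x C (standard_h_low d L N x K e h_ext) m) \<phi> =
      \<mu> * ((T m - h_ext) \<bullet> \<phi>)" for m \<phi>
    by (simp only: ip_N_eq_inner \<mu>_def inner_minus_left mult_minus_right minus_minus)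
  show ?thesis
    unfolding generated_by_energy_def field energy
    using quadratic_energy_gradient[OF lin sym] by blast
qed

section \<open>Length preservation and energy dissipation of the midpoint scheme\<close>

lemma midpoint_orthogonal:
  assumes "periodic_grid d L N x" and "midpoint_equations d L N x \<alpha> C h_low t mh v r"
  shows "v $ j \<bullet> mh $ j = 0"
proof -
  have "ip_N d L (node_dot v mh) (node_dot v mh) = 0"
    using assms(2) by (simp add: midpoint_equations_def)
  then have "node_dot v mh = 0"
    by (simp add: ip_N_self_eq_0_iff[OF assms(1)])
  then show ?thesis
    by (simp add: node_dot_def vec_eq_iff)
qed

lemma midpoint_dissipation:
  assumes "periodic_grid d L N x" and "midpoint_equations d L N x \<alpha> C h_low t mh v r"
    and "h_low mh t = h mh"
  shows "ip_N d L (h_eff_N d L N x C h mh) v = \<alpha> / (1 + \<alpha>\<^sup>2) * (norm_N d L v)\<^sup>2"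
proof -
  \<comment> \<open>Nodewise orthogonality makes the multiplier term vanish for the test function
    \<open>v\<close>, whatever \<open>r\<close> is.\<close>
  have "node_dot mh v = 0"
    using midpoint_orthogonal[OF assms(1,2)]
    by (simp add: node_dot_def vec_eq_iff inner_commute)
  moreover have "\<alpha> * ip_N d L v v + ip_N d L (node_cross mh v) v
      + (1 + \<alpha>\<^sup>2) * C * ip_N d L (neg_laplacian_N d L N x mh) v + ip_N d L (node_dot mh v) r
      = (1 + \<alpha>\<^sup>2) * ip_N d L (h_low mh t) v"
    using assms(2) unfolding midpoint_equations_def by blast
  ultimately have "\<alpha> * ip_N d L v v + (1 + \<alpha>\<^sup>2) * C * ip_N d L (neg_laplacian_N d L N x mh) v
      = (1 + \<alpha>\<^sup>2) * ip_N d L (h mh) v"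
    \<comment> \<open>The instance at \<open>0\<close> evaluates the multiplier term while the other
      products stay folded.\<close>
    by (simp add: node_cross_orthogonal assms(3) ip_N_eq_inner[of d L 0])
  moreover have "ip_N d L (h_eff_N d L N x C h mh) v =
      ip_N d L (h mh) v - C * ip_N d L (neg_laplacian_N d L N x mh) v"
    by (simp add: h_eff_N_def ip_N_eq_inner inner_add_left algebra_simps)
  ultimately have "(1 + \<alpha>\<^sup>2) * ip_N d L (h_eff_N d L N x C h mh) v = \<alpha> * ip_N d L v v"
    by (simp only: right_diff_distrib mult.assoc)
  moreover have "1 + \<alpha>\<^sup>2 > 0"
    by (simp add: add_pos_nonneg)
  ultimately show ?thesis
    by (simp add: norm_N_power2[OF assms(1)] field_simps)
qed

theorem proposition3:
  fixes d :: nat and L :: "3 \<Rightarrow> real" and N :: "3 \<Rightarrow> nat" and x :: "'p::finite \<Rightarrow> real^3"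
    and \<alpha> k C\<^sub>e\<^sub>x :: real
  assumes "periodic_grid d L N x"
    and "\<alpha> > 0" and "k > 0" and "C\<^sub>e\<^sub>x > 0"
  shows
    "(\<forall>(h_low :: real^3^'p \<Rightarrow> real \<Rightarrow> real^3^'p) (t_half :: real)
        (m :: real^3^'p) (m_half :: real^3^'p) (m_next :: real^3^'p) (v :: real^3^'p) (r :: real^'p).
        (\<forall>j. norm (m $ j) = 1) \<and>
        m_half = m + (k / 2) *\<^sub>R v \<and>
        m_next = m + k *\<^sub>R v \<and>
        midpoint_equations d L N x \<alpha> C\<^sub>e\<^sub>x h_low t_half m_half v r
        \<longrightarrow>
        (\<forall>j. norm (m_next $ j) = 1) \<and>
        (\<forall>(h :: real^3^'p \<Rightarrow> real^3^'p) (g :: real^3^'p \<Rightarrow> real).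
           (\<forall>u t. h_low u t = h u) \<and> generated_by_energy d L N x C\<^sub>e\<^sub>x h g
           \<longrightarrow>
           g m_next - g m = - (\<alpha> * k / (1 + \<alpha>\<^sup>2)) * (norm_N d L v)\<^sup>2 \<and>
           - (\<alpha> * k / (1 + \<alpha>\<^sup>2)) * (norm_N d L v)\<^sup>2 \<le> 0))
     \<and>
     (\<forall>(K :: real) (e :: real^3) (h_ext :: real^3^'p).
        norm e = 1 \<longrightarrow>
        generated_by_energy d L N x C\<^sub>e\<^sub>x
          (standard_h_low d L N x K e h_ext) (standard_energy d L N x C\<^sub>e\<^sub>x K e h_ext))"
proof (intro conjI allI impI; (elim conjE)?)
  fix h_low :: "real^3^'p \<Rightarrow> real \<Rightarrow> real^3^'p" and t m mh mn v :: "_" and r :: "real^'p"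
  assume unit: "\<forall>j. norm (m $ j) = 1" and mh: "mh = m + (k / 2) *\<^sub>R v"
    and mn: "mn = m + k *\<^sub>R v" and eqs: "midpoint_equations d L N x \<alpha> C\<^sub>e\<^sub>x h_low t mh v r"
  show "norm (mn $ j) = 1" for j
    using norm_add_scaleR_eq[of "v $ j" "m $ j" k] midpoint_orthogonal[OF assms(1) eqs, of j] unit
    by (simp add: mh mn)
  fix h :: "real^3^'p \<Rightarrow> real^3^'p" and g :: "real^3^'p \<Rightarrow> real"
  assume h: "\<forall>u t. h_low u t = h u" and g: "generated_by_energy d L N x C\<^sub>e\<^sub>x h g"
  \<comment> \<open>The midpoint rule meets the scheme here: the energy gradient is evaluated at the
    very state \<open>mh\<close> at which the equations are posed.\<close>
  have "g mn - g m = k * - ip_N d L (h_eff_N d L N x C\<^sub>e\<^sub>x h mh) v"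
    using g unfolding generated_by_energy_def mn mh by (intro quadratic_affine_midpoint_rule) auto
  also have "\<dots> = - (\<alpha> * k / (1 + \<alpha>\<^sup>2)) * (norm_N d L v)\<^sup>2"
    using midpoint_dissipation[OF assms(1) eqs, of h] h by simp
  finally show "g mn - g m = - (\<alpha> * k / (1 + \<alpha>\<^sup>2)) * (norm_N d L v)\<^sup>2" .
  show "- (\<alpha> * k / (1 + \<alpha>\<^sup>2)) * (norm_N d L v)\<^sup>2 \<le> 0"
    using assms(2,3) by simp
qed (rule generated_by_standard_energy)

end
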